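(* Let $\mathcal{N}=\{0,1,\ldots,N\}$ for some $N\in\mathbb{Z}_{\ge0}$, or $\mathcal{N}=\mathbb{Z}_{\ge0}$. Let $\{y_x\}_{x\in\mathcal{N}}\subset\mathbb{R}$, let $w_x>0$ and $\omega_n>0$ ($x,n\in\mathcal{N}$), and let $\{p_n\}_{n\in\mathcal{N}}$ be real polynomials with $p_n$ of degree $n$ which form a complete orthogonal system in the sense that $$\sum_{x\in\mathcal{N}}p_n(y_x)\,p_m(y_x)\,w_x=\omega_n^{-1}\,\delta_{n,m}\quad(n,m\in\mathcal{N}),\qquad \sum_{n\in\mathcal{N}}p_n(y_x)\,p_n(y_{x'})\,\omega_n=w_x^{-1}\,\delta_{x,x'}\quad(x,x'\in\mathcal{N}).$$ Assume that there exist polynomials $r_x$ of degree $x$ ($x\in\mathcal{N}$) and a subset $\{z_n\}_{n\in\mathcal{N}}$ of $\mathbb{R}$ such that $p_n(y_x)=r_x(z_n)$ for all $n,x\in\mathcal{N}$, and let $\delta_k$ ($k\in\mathcal{N}$) be the nonzero coefficients such that $$p_n(y_x)=\sum_{k=0}^{\min(n,x)}\delta_k\,\prod_{i=0}^{k-1}(z_i-z_n)\,\prod_{j=0}^{k-1}(y_j-y_x)\qquad(n,x\in\mathcal{N}).$$ Put $y_\nu:=y_N$ if $\mathcal{N}=\{0,1,\ldots,N\}$; if $\mathcal{N}=\mathbb{Z}_{\ge0}$, assume that the finite limit $y_\nu:=\lim_{x\to\infty}y_x$ exists and is not equal to any $y_x$ ($x\in\mathcal{N}$). Then for all $m\in\mathcal{N}$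 $$\delta_m=\frac1{\prod_{j=0}^{m-1}(y_j-y_\nu)}\,\sum_{n=0}^m p_n(y_\nu)\prod_{\substack{i=0\\ i\ne n}}^m(z_i-z_n)^{-1}.$$
   Context: Here $\delta_{n,m}$ with two indices denotes the Kronecker delta, while $\delta_k$ with one index denotes the coefficients in the displayed expansion; such nonzero coefficients exist and are unique under the stated assumptions. Empty products are equal to $1$. *)

theory Defs
  imports "HOL-Analysis.Analysis" "HOL-Computational_Algebra.Polynomial"
begin

end

(* The values p_n(y_nu) satisfy the same expansion, by continuity in the infinite case. In z_n this
   expansion is a Newton interpolation series in which delta_m times the product of the
   y_j - y_nu, j < m, is the leading coefficient, so it equals a divided difference at
   z_0, ..., z_m. *)
theory Submission
  imports Defs
begin

text \<open>Up to the sign (-1)^(card S - 1), this is the divided difference of the constant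
  function 1 at the nodes \<open>z n\<close>. Removing one of two nodes a, b gives the usual
  recursion (z a - z b) * D S = D (S - {a}) - D (S - {b}), and by induction its right-hand side
  vanishes.\<close>

lemma sum_prod_inverse_diff_eq_0:
  fixes z :: "'a \<Rightarrow> 'b::field"
  assumes "finite S" "inj_on z S" "2 \<le> card S"
  shows "(\<Sum>n\<in>S. \<Prod>i\<in>S - {n}. inverse (z i - z n)) = 0"
  using assms
proof (induction "card S" arbitrary: S rule: less_induct)
  case less
  define D where "D T = (\<Sum>n\<in>T. \<Prod>i\<in>T - {n}. inverse (z i - z n))" for T
  obtain a b where ab: "a \<in> S" "b \<in> S" "a \<noteq> b"
    using less.prems(3) by (metis card_2_iff' ex_card subset_iff)
  have zab: "z a \<noteq> z b"
    using ab less.prems(2) by (auto dest: inj_onD)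
  \<comment> \<open>With only two nodes, each smaller sum is a single empty product, hence 1 and not
    0. The induction hypothesis covers the smaller sums only from three nodes on.\<close>
  have D_eq: "D (S - {a}) = D (S - {b})"
  proof (cases "card S = 2")
    case True
    then have "S = {a, b}"
      using ab less.prems(1) by (metis card_2_iff doubleton_eq_iff insertE singletonD)
    then have "S - {a} = {b}" "S - {b} = {a}"
      using ab by auto
    then show ?thesis
      by (simp add: D_def)
  next
    case False
    have "D (S - {c}) = 0" if "c \<in> S" for c
      unfolding D_def
      using that False less.prems
      by (intro less.hyps) (auto intro: inj_on_subset simp: card_Diff_singleton)
    then show ?thesis
      using ab by simp
  qed
  \<comment> \<open>The part of each term that survives removing a and b. For n = a or n = b the
    removed set collapses to {a, b}, so the same \<open>R\<close> describes the end terms as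
    well.\<close>
  define R where "R n = (\<Prod>i\<in>S - {a, b, n}. inverse (z i - z n))" for n
  define U where "U = S - {a, b}"
  have R_ab: "R a = (\<Prod>i\<in>U. inverse (z i - z a))" "R b = (\<Prod>i\<in>U. inverse (z i - z b))"
    by (auto simp: R_def U_def intro!: prod.cong)
  have S: "S = insert a (insert b U)" "a \<notin> insert b U" "b \<notin> U" "finite U"
    using ab less.prems(1) by (auto simp: U_def)
  have Sa: "S - {a} = insert b U" and Sb: "S - {b} = insert a U"
    using ab by (auto simp: U_def)
  have da: "(\<Prod>i\<in>S - {a}. inverse (z i - z a)) = inverse (z b - z a) * R a"
    unfolding Sa R_ab using S(3,4) by simp
  have db: "(\<Prod>i\<in>S - {b}. inverse (z i - z b)) = inverse (z a - z b) * R b"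
    unfolding Sb R_ab using S(2,4) by simp
  have dU: "(\<Prod>i\<in>S - {n}. inverse (z i - z n)) =
      inverse (z a - z n) * inverse (z b - z n) * R n"
    and dUa: "(\<Prod>i\<in>S - {a} - {n}. inverse (z i - z n)) = inverse (z b - z n) * R n"
    and dUb: "(\<Prod>i\<in>S - {b} - {n}. inverse (z i - z n)) = inverse (z a - z n) * R n"
    if "n \<in> U" for n
  proof -
    define T where "T = S - {a, b, n}"
    have sets: "S - {n} = insert a (insert b T)" "S - {a} - {n} = insert b T"
      "S - {b} - {n} = insert a T" and T: "a \<notin> insert b T" "a \<notin> T" "b \<notin> T" "finite T"
      using that ab less.prems(1) by (auto simp: U_def T_def)
    show "(\<Prod>i\<in>S - {n}. inverse (z i - z n)) =
        inverse (z a - z n) * inverse (z b - z n) * R n"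
      "(\<Prod>i\<in>S - {a} - {n}. inverse (z i - z n)) = inverse (z b - z n) * R n"
      "(\<Prod>i\<in>S - {b} - {n}. inverse (z i - z n)) = inverse (z a - z n) * R n"
      unfolding sets R_def T_def[symmetric] using T by (simp_all add: mult.assoc)
  qed
  have DS: "D S = inverse (z b - z a) * R a + inverse (z a - z b) * R b +
      (\<Sum>n\<in>U. inverse (z a - z n) * inverse (z b - z n) * R n)"
  proof -
    have "D S = (\<Sum>n\<in>insert a (insert b U). \<Prod>i\<in>S - {n}. inverse (z i - z n))"
      by (simp add: D_def flip: S(1))
    then show ?thesis
      using S(2-4) dU da db by simp
  qed
  have Ra: "(\<Prod>i\<in>S - {b} - {a}. inverse (z i - z a)) = R a"
    and Rb: "(\<Prod>i\<in>S - {a} - {b}. inverse (z i - z b)) = R b"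
    by (auto simp: R_def intro: prod.cong)
  have DSa: "D (S - {a}) = R b + (\<Sum>n\<in>U. inverse (z b - z n) * R n)"
  proof -
    have "D (S - {a}) = (\<Sum>n\<in>insert b U. \<Prod>i\<in>S - {a} - {n}. inverse (z i - z n))"
      by (simp add: D_def Sa)
    then show ?thesis
      using S(2-4) dUa Rb by simp
  qed
  have DSb: "D (S - {b}) = R a + (\<Sum>n\<in>U. inverse (z a - z n) * R n)"
  proof -
    have "D (S - {b}) = (\<Sum>n\<in>insert a U. \<Prod>i\<in>S - {b} - {n}. inverse (z i - z n))"
      by (simp add: D_def Sb)
    then show ?thesis
      using S(2-4) dUb Ra by simp
  qed
  \<comment> \<open>Partial fractions: the recursion holds term by term at the nodes other than a
    and b. The terms at a and b are matched separately below.\<close>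
  have "(z a - z b) * (inverse (z a - z n) * inverse (z b - z n) * R n) =
      inverse (z b - z n) * R n - inverse (z a - z n) * R n" if "n \<in> U" for n
  proof -
    have "z a \<noteq> z n" "z b \<noteq> z n"
      using that ab less.prems(2) by (auto simp: U_def dest: inj_onD)
    then show ?thesis
      by (simp add: field_simps)
  qed
  then have "(z a - z b) * (\<Sum>n\<in>U. inverse (z a - z n) * inverse (z b - z n) * R n) =
      (\<Sum>n\<in>U. inverse (z b - z n) * R n) - (\<Sum>n\<in>U. inverse (z a - z n) * R n)"
    by (simp add: sum_distrib_left sum_subtractf)
  moreover have "(z a - z b) * (inverse (z b - z a) * R a) = - R a"
    "(z a - z b) * (inverse (z a - z b) * R b) = R b"
    using zab by (simp_all add: field_simps)
  ultimately have "(z a - z b) * D S = D (S - {a}) - D (S - {b})"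
    unfolding DS DSa DSb by (simp only: distrib_left) simp
  then show ?case
    using D_eq zab by (simp add: D_def)
qed

text \<open>The divided difference extracts the leading coefficient of a Newton expansion. The k-th
  Newton basis polynomial vanishes at the nodes n < k, and at n \<ge> k it cancels the first k
  factors of the weight. What remains is the divided difference of 1 at the nodes k, ..., m. The
  signs from writing z i - z n instead of z n - z i cancel for k = m.\<close>

lemma divided_difference_newton_basis:
  fixes z :: "nat \<Rightarrow> 'a::field"
  assumes inj: "inj_on z {0..m}" and "k \<le> m"
  shows "(\<Sum>n=0..m. (\<Prod>i<k. z i - z n) * (\<Prod>i\<in>{0..m} - {n}. inverse (z i - z n))) =
    of_bool (k = m)"
proof -
  have "(\<Prod>i<k. z i - z n) * (\<Prod>i\<in>{0..m} - {n}. inverse (z i - z n)) =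
      (\<Prod>i\<in>{k..m} - {n}. inverse (z i - z n))" if "n \<in> {k..m}" for n
  proof -
    have split: "{0..m} - {n} = {..<k} \<union> ({k..m} - {n})" "{..<k} \<inter> ({k..m} - {n}) = {}"
      using that by auto
    have "z i \<noteq> z n" if "i < k" for i
      using inj that \<open>n \<in> {k..m}\<close> by (auto dest!: inj_onD)
    then have "(\<Prod>i<k. z i - z n) * (\<Prod>i<k. inverse (z i - z n)) = 1"
      by (simp flip: prod.distrib)
    then show ?thesis
      using split by (simp add: prod.union_disjoint flip: mult.assoc)
  qed
  moreover have "(\<Prod>i<k. z i - z n) = 0" if "n < k" for n
    using that by auto
  ultimately have "(\<Sum>n=0..m. (\<Prod>i<k. z i - z n) * (\<Prod>i\<in>{0..m} - {n}. inverse (z i - z n))) =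
      (\<Sum>n=k..m. \<Prod>i\<in>{k..m} - {n}. inverse (z i - z n))"
    by (intro sum.mono_neutral_cong_right) auto
  \<comment> \<open>For k = m a single node with an empty product is left, which gives 1.\<close>
  also have "\<dots> = of_bool (k = m)"
  proof (cases "k = m")
    case False
    with \<open>k \<le> m\<close> inj show ?thesis
      by (subst sum_prod_inverse_diff_eq_0) (auto intro: inj_on_subset)
  qed simp
  finally show ?thesis .
qed

text \<open>If \<open>g\<close> identified two distinct indices, their functions would agree on B,
  and the inner product of the two, which is 0, would be the positive squared norm of one. Both
  orthogonality relations are instances, one yielding distinct \<open>z n\<close> and the other
  distinct \<open>y x\<close>.\<close>

lemma inj_on_of_orthogonal:
  fixes f :: "'a \<Rightarrow> 'b \<Rightarrow> real" and c v :: "_ \<Rightarrow> real"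
  assumes orth: "\<And>n m. n \<in> A \<Longrightarrow> m \<in> A \<Longrightarrow>
      ((\<lambda>x. f n x * f m x * v x) has_sum (inverse (c n) * of_bool (n = m))) B"
    and pos: "\<And>n. n \<in> A \<Longrightarrow> c n > 0"
    and factor: "\<And>n m x. n \<in> A \<Longrightarrow> m \<in> A \<Longrightarrow> x \<in> B \<Longrightarrow> g n = g m \<Longrightarrow> f n x = f m x"
  shows "inj_on g A"
proof (rule inj_onI, rule ccontr)
  fix n m assume nm: "n \<in> A" "m \<in> A" "g n = g m" "n \<noteq> m"
  have "((\<lambda>x. f n x * f m x * v x) has_sum inverse (c n)) B"
  proof (subst has_sum_cong)
    show "f n x * f m x * v x = f n x * f n x * v x" if "x \<in> B" for x
      using factor[OF nm(1,2) that nm(3)] by simp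
    show "((\<lambda>x. f n x * f n x * v x) has_sum inverse (c n)) B"
      using orth[OF nm(1,1)] by simp
  qed
  moreover have "((\<lambda>x. f n x * f m x * v x) has_sum 0) B"
    using orth[OF nm(1,2)] nm(4) by simp
  ultimately have "inverse (c n) = 0"
    by (rule has_sum_unique)
  with pos[OF nm(1)] show False
    by simp
qed

theorem mainTheorem5:
  fixes \<N> :: "nat set"
    and y z w \<omega> \<delta> :: "nat \<Rightarrow> real"
    and p r :: "nat \<Rightarrow> real poly"
    and y\<^sub>\<nu> :: real
  assumes index_set: "(\<exists>N. \<N> = {0..N}) \<or> \<N> = UNIV"
    and w_pos: "\<And>x. x \<in> \<N> \<Longrightarrow> w x > 0"
    and \<omega>_pos: "\<And>n. n \<in> \<N> \<Longrightarrow> \<omega> n > 0"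
    and degree_p: "\<And>n. n \<in> \<N> \<Longrightarrow> degree (p n) = n"
    and orthogonality:
      "\<And>n m. n \<in> \<N> \<Longrightarrow> m \<in> \<N> \<Longrightarrow>
        ((\<lambda>x. poly (p n) (y x) * poly (p m) (y x) * w x)
          has_sum (inverse (\<omega> n) * of_bool (n = m))) \<N>"
    and dual_orthogonality:
      "\<And>x x'. x \<in> \<N> \<Longrightarrow> x' \<in> \<N> \<Longrightarrow>
        ((\<lambda>n. poly (p n) (y x) * poly (p n) (y x') * \<omega> n)
          has_sum (inverse (w x) * of_bool (x = x'))) \<N>"
    and degree_r: "\<And>x. x \<in> \<N> \<Longrightarrow> degree (r x) = x"
    and duality: "\<And>n x. n \<in> \<N> \<Longrightarrow> x \<in> \<N> \<Longrightarrow> poly (p n) (y x) = poly (r x) (z n)"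
    and \<delta>_nonzero: "\<And>k. k \<in> \<N> \<Longrightarrow> \<delta> k \<noteq> 0"
    and expansion:
      "\<And>n x. n \<in> \<N> \<Longrightarrow> x \<in> \<N> \<Longrightarrow>
        poly (p n) (y x) =
          (\<Sum>k=0..min n x. \<delta> k * (\<Prod>i<k. (z i - z n)) * (\<Prod>j<k. (y j - y x)))"
    and y\<^sub>\<nu>_finite: "\<And>N. \<N> = {0..N} \<Longrightarrow> y\<^sub>\<nu> = y N"
    and y\<^sub>\<nu>_infinite: "\<N> = UNIV \<Longrightarrow> y \<longlonglongrightarrow> y\<^sub>\<nu> \<and> (\<forall>x. y\<^sub>\<nu> \<noteq> y x)"
  shows "\<forall>m\<in>\<N>. \<delta> m =
    1 / (\<Prod>j<m. (y j - y\<^sub>\<nu>)) *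
      (\<Sum>n=0..m. poly (p n) y\<^sub>\<nu> * (\<Prod>i\<in>{0..m} - {n}. inverse (z i - z n)))"
proof
  fix m assume m: "m \<in> \<N>"
  have below: "n \<in> \<N>" if "n \<le> m" for n
    using index_set m that by auto
  \<comment> \<open>By duality the value is \<open>poly (r x) (z n)\<close>, so it depends on n only
    through \<open>z n\<close>.\<close>
  have "inj_on z \<N>"
    by (rule inj_on_of_orthogonal[where f = "\<lambda>n x. poly (p n) (y x)", OF orthogonality \<omega>_pos])
      (simp_all add: duality)
  then have inj_z: "inj_on z {0..m}"
    by (rule inj_on_subset) (auto intro: below)
  have inj_y: "inj_on y \<N>"
    by (rule inj_on_of_orthogonal[where f = "\<lambda>x n. poly (p n) (y x)", OF dual_orthogonality w_pos])
      simp_all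
  \<comment> \<open>For fixed n, the \<open>A k n\<close> are the Newton basis values at
    \<open>z n\<close>, the \<open>B k t\<close> enter the coefficients, and \<open>I n\<close> is
    the divided difference weight.\<close>
  define A where "A k n = (\<Prod>i<k. z i - z n)" for k n
  define B where "B k t = (\<Prod>j<k. y j - t)" for k t
  define I where "I n = (\<Prod>i\<in>{0..m} - {n}. inverse (z i - z n))" for n
  \<comment> \<open>In the finite case j < m \<le> N, so j differs from the index N of
    \<open>y\<^sub>\<nu>\<close> and the nodes are distinct.\<close>
  have y\<^sub>\<nu>_neq: "y j \<noteq> y\<^sub>\<nu>" if "j < m" for j
    using index_set
  proof
    assume "\<exists>N. \<N> = {0..N}"
    then obtain N where N: "\<N> = {0..N}" ..
    with m that have "j \<in> \<N>" "N \<in> \<N>" "j \<noteq> N"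
      by auto
    with inj_y y\<^sub>\<nu>_finite[OF N] show ?thesis
      by (auto dest: inj_onD)
  next
    assume "\<N> = UNIV"
    from y\<^sub>\<nu>_infinite[OF this] show ?thesis
      by metis
  qed
  have B_nz: "B m y\<^sub>\<nu> \<noteq> 0"
    using y\<^sub>\<nu>_neq by (simp add: B_def)
  \<comment> \<open>Every term with k above \<open>min n x\<close> contains the factor z n - z n or
    y x - y x. The upper limit can thus be raised to m, which no longer depends on x.\<close>
  have at_node: "poly (p n) (y x) = (\<Sum>k=0..m. \<delta> k * A k n * B k (y x))"
    if "n \<le> m" "x \<in> \<N>" for n x
  proof -
    have "A k n = 0 \<or> B k (y x) = 0" if "\<not> k \<le> min n x" for k
    proof -
      have "n < k \<or> x < k"
        using that by auto
      then show ?thesis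
        by (auto simp: A_def B_def)
    qed
    then have "(\<Sum>k=0..min n x. \<delta> k * A k n * B k (y x)) = (\<Sum>k=0..m. \<delta> k * A k n * B k (y x))"
      using \<open>n \<le> m\<close> by (intro sum.mono_neutral_left) auto
    then show ?thesis
      using expansion[OF below[OF \<open>n \<le> m\<close>] \<open>x \<in> \<N>\<close>] by (simp add: A_def B_def)
  qed
  \<comment> \<open>In the finite case \<open>y\<^sub>\<nu>\<close> is itself a node. In the
    infinite case, thanks to the fixed upper limit, both sides are polynomials in
    \<open>y x\<close>, and the identity passes to the limit.\<close>
  have at_\<nu>: "poly (p n) y\<^sub>\<nu> = (\<Sum>k=0..m. \<delta> k * A k n * B k y\<^sub>\<nu>)" if "n \<le> m" for n
    using index_set
  proof
    assume "\<exists>N. \<N> = {0..N}"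
    then obtain N where N: "\<N> = {0..N}" ..
    then show ?thesis
      using at_node[OF that, of N] y\<^sub>\<nu>_finite[OF N] by simp
  next
    assume UNIV: "\<N> = UNIV"
    have lim: "y \<longlonglongrightarrow> y\<^sub>\<nu>"
      using y\<^sub>\<nu>_infinite[OF UNIV] by simp
    have "(\<lambda>x. poly (p n) (y x)) \<longlonglongrightarrow> poly (p n) y\<^sub>\<nu>"
      by (intro tendsto_intros lim)
    moreover have "(\<lambda>x. poly (p n) (y x)) \<longlonglongrightarrow> (\<Sum>k=0..m. \<delta> k * A k n * B k y\<^sub>\<nu>)"
    proof -
      have "(\<lambda>x. \<Sum>k=0..m. \<delta> k * A k n * B k (y x)) \<longlonglongrightarrow> (\<Sum>k=0..m. \<delta> k * A k n * B k y\<^sub>\<nu>)"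
        unfolding B_def by (intro tendsto_intros lim)
      moreover have "poly (p n) (y x) = (\<Sum>k=0..m. \<delta> k * A k n * B k (y x))" for x
        using that UNIV by (intro at_node) simp_all
      ultimately show ?thesis
        by presburger
    qed
    ultimately show ?thesis
      by (rule LIMSEQ_unique)
  qed
  have "(\<Sum>n=0..m. poly (p n) y\<^sub>\<nu> * I n) =
      (\<Sum>n=0..m. \<Sum>k=0..m. \<delta> k * B k y\<^sub>\<nu> * (A k n * I n))"
    by (simp add: at_\<nu> sum_distrib_left mult_ac)
  also have "\<dots> = (\<Sum>k=0..m. \<delta> k * B k y\<^sub>\<nu> * (\<Sum>n=0..m. A k n * I n))"
    by (subst sum.swap) (simp add: sum_distrib_left)
  \<comment> \<open>The inner sum over n is the divided difference of the k-th Newton basis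
    polynomial, so only the leading coefficient k = m survives.\<close>
  also have "\<dots> = (\<Sum>k=0..m. \<delta> k * B k y\<^sub>\<nu> * of_bool (k = m))"
    using divided_difference_newton_basis[OF inj_z] by (simp add: A_def I_def)
  also have "\<dots> = \<delta> m * B m y\<^sub>\<nu>"
    by simp
  finally show "\<delta> m = 1 / (\<Prod>j<m. (y j - y\<^sub>\<nu>)) *
      (\<Sum>n=0..m. poly (p n) y\<^sub>\<nu> * (\<Prod>i\<in>{0..m} - {n}. inverse (z i - z n)))"
    using B_nz by (simp add: B_def I_def)
qed

end
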